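(* The logics $\mathit{S1SP}_\equiv$, $\mathit{S3}_\equiv$, $\mathit{S4}_\equiv$ and $\mathit{S5}_\equiv$ are the dual $\mathit{SCI}$-theories of the modal logics $\mathit{S1SP}$, $\mathit{S3}$, $\mathit{S4}$ and $\mathit{S5}$, respectively.
   Context: Languages: $Fm_\equiv$ is the set of formulas built from variables $V=\{x_0,x_1,\dots\}$, $\bot,\top,\neg,\vee,\wedge,\rightarrow$ and a binary connective $\equiv$. $Fm_\square$ is built from the same variables and classical connectives and a unary operator $\square$. $\varphi\leftrightarrow\psi$ abbreviates $(\varphi\rightarrow\psi)\wedge(\psi\rightarrow\varphi)$. In $Fm_\equiv$, $\square\varphi$ abbreviates $\varphi\equiv\top$. In $Fm_\square$, $\varphi\equiv\psi$ abbreviates $\square(\varphi\leftrightarrow\psi)$. $\mathit{SCI}$ (in $Fm_\equiv$): axioms are all substitution instances of classical tautologies and all formulas $\varphi\equiv\varphi$; $(\varphi\equiv\psi)\rightarrow(\varphi\rightarrow\psi)$; $(\varphi\equiv\psi)\rightarrow(\neg\varphi\equiv\neg\psi)$; $((\varphi_1\equiv\psi_1)\wedge(\varphi_2\equiv\psi_2))\rightarrow((\varphi_1*\varphi_2)\equiv(\psi_1*\psi_2))$, $*\in\{\vee,\wedge,\rightarrow,\equiv\}$; rule Modus Ponens (MP). Schemes, read in either language: (CPC) substitution instances of classical tautologies; (1) $(\chi\equiv\psi)\leftrightarrow\square(\chi\leftrightarrow\psi)$; (2) $\square\varphi\rightarrow\varphi$; (3') $(\square(\varphi\rightarrow\psi)\wedge\square(\psi\rightarrow\chi))\rightarrow\square(\varphi\rightarrow\chi)$;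 (3) $\square(\varphi\rightarrow\psi)\rightarrow\square(\square\varphi\rightarrow\square\psi)$; (4) $\square\varphi\rightarrow\square\square\varphi$; (5) $\neg\square\varphi\rightarrow\square\neg\square\varphi$; SP: $(\varphi\equiv\psi)\rightarrow(\chi[x:=\varphi]\equiv\chi[x:=\psi])$. In each system below, $\varPhi\vdash\varphi$ means there is a finite sequence ending in $\varphi$ each member of which is in $\varPhi$, or an axiom, or $\square\psi$ for an axiom $\psi$ (rule AN, Axiom Necessitation), or (for $\mathit{S1SP}$ and $\mathit{S1SP}_\equiv$) an instance of SP (SP is not an axiom, so AN does not apply to it), or obtained from earlier members by MP. Modal systems in $Fm_\square$: $\mathit{S1SP}$ has axioms (CPC), (2), (3') plus theorem scheme SP; $\mathit{S3}$ has axioms (CPC), (2), (3'), (3); $\mathit{S4}$ adds axiom (4) to $\mathit{S3}$; $\mathit{S5}$ adds axiom (5) to $\mathit{S4}$. Systems in $Fm_\equiv$ (with $\square\varphi:=(\varphi\equiv\top)$): $\mathit{S1SP}_\equiv$ has axioms (CPC), (1), (2), (3') plus theorem scheme SP; $\mathit{S3}_\equiv$ has axioms (CPC), (1), (2), (3); $\mathit{S4}_\equiv$ has axioms (CPC), (1), (2), (3), (4); $\mathit{S5}_\equiv$ has axioms (CPC), (1), (2), (3), (4), (5). Translations: $\mathit{box}\colon Fm_\equiv\to Fm_\square$ is the identity on variables, $\bot$, $\top$, commutes with $\neg,\wedge,\vee,\rightarrow$, and $\mathit{box}(\varphi\equiv\psi):=\square(\mathit{box}(\varphi)\leftrightarrow\mathit{box}(\psi))$.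 $\mathit{id}\colon Fm_\square\to Fm_\equiv$ is the identity on variables, $\bot$, $\top$, commutes with $\neg,\wedge,\vee,\rightarrow$, and $\mathit{id}(\square\varphi):=(\mathit{id}(\varphi)\equiv\top)$. For sets $\varPhi$, $\mathit{box}(\varPhi)$ and $\mathit{id}(\varPhi)$ are the elementwise images. Duality: Let $\mathcal{L}$ be a modal logic in $Fm_\square$ containing $\mathit{S1SP}$, and let $\mathcal{L}_\equiv$ be an extension of $\mathit{SCI}$ in $Fm_\equiv$ containing all formulas $(\chi\equiv\psi)\equiv\square(\chi\leftrightarrow\psi)$ as theorems. $\mathcal{L}_\equiv$ is called the dual $\mathit{SCI}$-theory of $\mathcal{L}$ if one of the following two conditions holds: (i) for all $\varPhi\cup\{\varphi\}\subseteq Fm_\equiv$: $\varPhi\vdash_{\mathcal{L}_\equiv}\varphi\Leftrightarrow\mathit{box}(\varPhi)\vdash_{\mathcal{L}}\mathit{box}(\varphi)$; (ii) for all $\varPhi\cup\{\varphi\}\subseteq Fm_\square$: $\varPhi\vdash_{\mathcal{L}}\varphi\Leftrightarrow\mathit{id}(\varPhi)\vdash_{\mathcal{L}_\equiv}\mathit{id}(\varphi)$. (The claim includes that each pair of systems satisfies the prerequisites on $\mathcal{L}$ and $\mathcal{L}_\equiv$.) *)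

theory Defs
  imports Main
begin

text \<open>Purely classical formulas; used only to say what a classical tautology is.\<close>

datatype cfm = CVar nat | CBot | CTop | CNeg cfm | COr cfm cfm | CAnd cfm cfm | CImp cfm cfm

primrec ceval :: "(nat \<Rightarrow> bool) \<Rightarrow> cfm \<Rightarrow> bool" where
  "ceval v (CVar n) = v n"
| "ceval v CBot = False"
| "ceval v CTop = True"
| "ceval v (CNeg p) = (\<not> ceval v p)"
| "ceval v (COr p q) = (ceval v p \<or> ceval v q)"
| "ceval v (CAnd p q) = (ceval v p \<and> ceval v q)"
| "ceval v (CImp p q) = (ceval v p \<longrightarrow> ceval v q)"

definition tautology :: "cfm \<Rightarrow> bool" where
  "tautology p \<longleftrightarrow> (\<forall>v. ceval v p)"


section \<open>The two languages\<close>

text \<open>Subscript \<open>e\<close> marks the language with the identity connective,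
  subscript \<open>b\<close> the modal language.\<close>

datatype fme =
    EVar nat
  | EBot ("\<bottom>\<^sub>e")
  | ETop ("\<top>\<^sub>e")
  | ENeg fme ("\<not>\<^sub>e _" [80] 80)
  | EOr fme fme (infixr "\<or>\<^sub>e" 65)
  | EAnd fme fme (infixr "\<and>\<^sub>e" 70)
  | EImp fme fme (infixr "\<rightarrow>\<^sub>e" 60)
  | EId fme fme (infix "\<equiv>\<^sub>e" 75)

datatype fmb =
    BVar nat
  | BBot ("\<bottom>\<^sub>b")
  | BTop ("\<top>\<^sub>b")
  | BNeg fmb ("\<not>\<^sub>b _" [80] 80)
  | BOr fmb fmb (infixr "\<or>\<^sub>b" 65)
  | BAnd fmb fmb (infixr "\<and>\<^sub>b" 70)
  | BImp fmb fmb (infixr "\<rightarrow>\<^sub>b" 60)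
  | BBox fmb ("\<box>\<^sub>b _" [80] 80)

abbreviation EIff :: "fme \<Rightarrow> fme \<Rightarrow> fme" (infix "\<leftrightarrow>\<^sub>e" 58) where
  "p \<leftrightarrow>\<^sub>e q \<equiv> (p \<rightarrow>\<^sub>e q) \<and>\<^sub>e (q \<rightarrow>\<^sub>e p)"

abbreviation EBox :: "fme \<Rightarrow> fme" ("\<box>\<^sub>e _" [80] 80) where
  "\<box>\<^sub>e p \<equiv> p \<equiv>\<^sub>e \<top>\<^sub>e"

abbreviation BIff :: "fmb \<Rightarrow> fmb \<Rightarrow> fmb" (infix "\<leftrightarrow>\<^sub>b" 58) where
  "p \<leftrightarrow>\<^sub>b q \<equiv> (p \<rightarrow>\<^sub>b q) \<and>\<^sub>b (q \<rightarrow>\<^sub>b p)"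

abbreviation BId :: "fmb \<Rightarrow> fmb \<Rightarrow> fmb" (infix "\<equiv>\<^sub>b" 75) where
  "p \<equiv>\<^sub>b q \<equiv> \<box>\<^sub>b (p \<leftrightarrow>\<^sub>b q)"

text \<open>Simultaneous substitution into a classical formula.\<close>

primrec cinst_e :: "(nat \<Rightarrow> fme) \<Rightarrow> cfm \<Rightarrow> fme" where
  "cinst_e s (CVar n) = s n"
| "cinst_e s CBot = \<bottom>\<^sub>e"
| "cinst_e s CTop = \<top>\<^sub>e"
| "cinst_e s (CNeg p) = \<not>\<^sub>e cinst_e s p"
| "cinst_e s (COr p q) = cinst_e s p \<or>\<^sub>e cinst_e s q"
| "cinst_e s (CAnd p q) = cinst_e s p \<and>\<^sub>e cinst_e s q"
| "cinst_e s (CImp p q) = cinst_e s p \<rightarrow>\<^sub>e cinst_e s q"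

primrec cinst_b :: "(nat \<Rightarrow> fmb) \<Rightarrow> cfm \<Rightarrow> fmb" where
  "cinst_b s (CVar n) = s n"
| "cinst_b s CBot = \<bottom>\<^sub>b"
| "cinst_b s CTop = \<top>\<^sub>b"
| "cinst_b s (CNeg p) = \<not>\<^sub>b cinst_b s p"
| "cinst_b s (COr p q) = cinst_b s p \<or>\<^sub>b cinst_b s q"
| "cinst_b s (CAnd p q) = cinst_b s p \<and>\<^sub>b cinst_b s q"
| "cinst_b s (CImp p q) = cinst_b s p \<rightarrow>\<^sub>b cinst_b s q"

text \<open>\<open>subst_e c x p\<close> is \<open>c[x := p]\<close>, and similarly for \<open>subst_b\<close>.\<close>

primrec subst_e :: "fme \<Rightarrow> nat \<Rightarrow> fme \<Rightarrow> fme" where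
  "subst_e (EVar n) x r = (if n = x then r else EVar n)"
| "subst_e \<bottom>\<^sub>e x r = \<bottom>\<^sub>e"
| "subst_e \<top>\<^sub>e x r = \<top>\<^sub>e"
| "subst_e (\<not>\<^sub>e p) x r = \<not>\<^sub>e subst_e p x r"
| "subst_e (p \<or>\<^sub>e q) x r = subst_e p x r \<or>\<^sub>e subst_e q x r"
| "subst_e (p \<and>\<^sub>e q) x r = subst_e p x r \<and>\<^sub>e subst_e q x r"
| "subst_e (p \<rightarrow>\<^sub>e q) x r = subst_e p x r \<rightarrow>\<^sub>e subst_e q x r"
| "subst_e (p \<equiv>\<^sub>e q) x r = subst_e p x r \<equiv>\<^sub>e subst_e q x r"

primrec subst_b :: "fmb \<Rightarrow> nat \<Rightarrow> fmb \<Rightarrow> fmb" where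
  "subst_b (BVar n) x r = (if n = x then r else BVar n)"
| "subst_b \<bottom>\<^sub>b x r = \<bottom>\<^sub>b"
| "subst_b \<top>\<^sub>b x r = \<top>\<^sub>b"
| "subst_b (\<not>\<^sub>b p) x r = \<not>\<^sub>b subst_b p x r"
| "subst_b (p \<or>\<^sub>b q) x r = subst_b p x r \<or>\<^sub>b subst_b q x r"
| "subst_b (p \<and>\<^sub>b q) x r = subst_b p x r \<and>\<^sub>b subst_b q x r"
| "subst_b (p \<rightarrow>\<^sub>b q) x r = subst_b p x r \<rightarrow>\<^sub>b subst_b q x r"
| "subst_b (\<box>\<^sub>b p) x r = \<box>\<^sub>b subst_b p x r"


section \<open>Derivations\<close>

text \<open>A finite sequence each of whose members is in \<open>G\<close> or follows from earlier members
  by Modus Ponens; \<open>imp\<close> is the implication of the language at hand.\<close>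

definition derivation :: "('f \<Rightarrow> 'f \<Rightarrow> 'f) \<Rightarrow> 'f set \<Rightarrow> 'f list \<Rightarrow> bool" where
  "derivation imp G ps \<longleftrightarrow>
     (\<forall>i<length ps. ps ! i \<in> G \<or> (\<exists>j<i. \<exists>k<i. ps ! k = imp (ps ! j) (ps ! i)))"

text \<open>Every logic considered has Modus Ponens as its only rule with premises.  A logic \<open>L\<close> is
  therefore represented by the set of all formulas that may be entered in a derivation without
  premises: its axioms, and, where the system provides for it, the boxed axioms (Axiom
  Necessitation) and the instances of SP.  This is not the set of theorems of the logic.\<close>

definition derives_e :: "fme set \<Rightarrow> fme set \<Rightarrow> fme \<Rightarrow> bool" ("_ \<turnstile>\<^sub>e[_] _" [55, 0, 55] 50) where
  "H \<turnstile>\<^sub>e[L] p \<longleftrightarrow> (\<exists>ps. ps \<noteq> [] \<and> last ps = p \<and> derivation EImp (H \<union> L) ps)"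

definition derives_b :: "fmb set \<Rightarrow> fmb set \<Rightarrow> fmb \<Rightarrow> bool" ("_ \<turnstile>\<^sub>b[_] _" [55, 0, 55] 50) where
  "H \<turnstile>\<^sub>b[L] p \<longleftrightarrow> (\<exists>ps. ps \<noteq> [] \<and> last ps = p \<and> derivation BImp (H \<union> L) ps)"


section \<open>Schemes\<close>

definition CPC_e :: "fme set" where
  "CPC_e = {cinst_e s t | s t. tautology t}"

definition ax1_e :: "fme set" where
  "ax1_e = {(p \<equiv>\<^sub>e q) \<leftrightarrow>\<^sub>e \<box>\<^sub>e (p \<leftrightarrow>\<^sub>e q) | p q. True}"

definition ax2_e :: "fme set" where
  "ax2_e = {\<box>\<^sub>e p \<rightarrow>\<^sub>e p | p. True}"

definition ax3'_e :: "fme set" where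
  "ax3'_e = {(\<box>\<^sub>e (p \<rightarrow>\<^sub>e q) \<and>\<^sub>e \<box>\<^sub>e (q \<rightarrow>\<^sub>e r)) \<rightarrow>\<^sub>e \<box>\<^sub>e (p \<rightarrow>\<^sub>e r) | p q r. True}"

definition ax3_e :: "fme set" where
  "ax3_e = {\<box>\<^sub>e (p \<rightarrow>\<^sub>e q) \<rightarrow>\<^sub>e \<box>\<^sub>e (\<box>\<^sub>e p \<rightarrow>\<^sub>e \<box>\<^sub>e q) | p q. True}"

definition ax4_e :: "fme set" where
  "ax4_e = {\<box>\<^sub>e p \<rightarrow>\<^sub>e \<box>\<^sub>e (\<box>\<^sub>e p) | p. True}"

definition ax5_e :: "fme set" where
  "ax5_e = {\<not>\<^sub>e (\<box>\<^sub>e p) \<rightarrow>\<^sub>e \<box>\<^sub>e (\<not>\<^sub>e (\<box>\<^sub>e p)) | p. True}"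

definition SP_e :: "fme set" where
  "SP_e = {(p \<equiv>\<^sub>e q) \<rightarrow>\<^sub>e (subst_e c x p \<equiv>\<^sub>e subst_e c x q) | p q c x. True}"

definition CPC_b :: "fmb set" where
  "CPC_b = {cinst_b s t | s t. tautology t}"

definition ax2_b :: "fmb set" where
  "ax2_b = {\<box>\<^sub>b p \<rightarrow>\<^sub>b p | p. True}"

definition ax3'_b :: "fmb set" where
  "ax3'_b = {(\<box>\<^sub>b (p \<rightarrow>\<^sub>b q) \<and>\<^sub>b \<box>\<^sub>b (q \<rightarrow>\<^sub>b r)) \<rightarrow>\<^sub>b \<box>\<^sub>b (p \<rightarrow>\<^sub>b r) | p q r. True}"

definition ax3_b :: "fmb set" where
  "ax3_b = {\<box>\<^sub>b (p \<rightarrow>\<^sub>b q) \<rightarrow>\<^sub>b \<box>\<^sub>b (\<box>\<^sub>b p \<rightarrow>\<^sub>b \<box>\<^sub>b q) | p q. True}"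

definition ax4_b :: "fmb set" where
  "ax4_b = {\<box>\<^sub>b p \<rightarrow>\<^sub>b \<box>\<^sub>b (\<box>\<^sub>b p) | p. True}"

definition ax5_b :: "fmb set" where
  "ax5_b = {\<not>\<^sub>b (\<box>\<^sub>b p) \<rightarrow>\<^sub>b \<box>\<^sub>b (\<not>\<^sub>b (\<box>\<^sub>b p)) | p. True}"

definition SP_b :: "fmb set" where
  "SP_b = {(p \<equiv>\<^sub>b q) \<rightarrow>\<^sub>b (subst_b c x p \<equiv>\<^sub>b subst_b c x q) | p q c x. True}"


section \<open>The systems\<close>

text \<open>SCI has no Axiom Necessitation.\<close>

definition SCI :: "fme set" where
  "SCI = CPC_e
     \<union> {p \<equiv>\<^sub>e p | p. True}
     \<union> {(p \<equiv>\<^sub>e q) \<rightarrow>\<^sub>e (p \<rightarrow>\<^sub>e q) | p q. True}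
     \<union> {(p \<equiv>\<^sub>e q) \<rightarrow>\<^sub>e ((\<not>\<^sub>e p) \<equiv>\<^sub>e (\<not>\<^sub>e q)) | p q. True}
     \<union> {((p1 \<equiv>\<^sub>e q1) \<and>\<^sub>e (p2 \<equiv>\<^sub>e q2)) \<rightarrow>\<^sub>e (f p1 p2 \<equiv>\<^sub>e f q1 q2) | f p1 q1 p2 q2.
          f \<in> {EOr, EAnd, EImp, EId}}"

definition with_AN_e :: "fme set \<Rightarrow> fme set" where
  "with_AN_e Ax = Ax \<union> {\<box>\<^sub>e p | p. p \<in> Ax}"

definition with_AN_b :: "fmb set \<Rightarrow> fmb set" where
  "with_AN_b Ax = Ax \<union> {\<box>\<^sub>b p | p. p \<in> Ax}"

definition S1SP :: "fmb set" where
  "S1SP = with_AN_b (CPC_b \<union> ax2_b \<union> ax3'_b) \<union> SP_b"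

definition S3 :: "fmb set" where
  "S3 = with_AN_b (CPC_b \<union> ax2_b \<union> ax3'_b \<union> ax3_b)"

definition S4 :: "fmb set" where
  "S4 = with_AN_b (CPC_b \<union> ax2_b \<union> ax3'_b \<union> ax3_b \<union> ax4_b)"

definition S5 :: "fmb set" where
  "S5 = with_AN_b (CPC_b \<union> ax2_b \<union> ax3'_b \<union> ax3_b \<union> ax4_b \<union> ax5_b)"

definition S1SP_eq :: "fme set" where
  "S1SP_eq = with_AN_e (CPC_e \<union> ax1_e \<union> ax2_e \<union> ax3'_e) \<union> SP_e"

definition S3_eq :: "fme set" where
  "S3_eq = with_AN_e (CPC_e \<union> ax1_e \<union> ax2_e \<union> ax3_e)"

definition S4_eq :: "fme set" where
  "S4_eq = with_AN_e (CPC_e \<union> ax1_e \<union> ax2_e \<union> ax3_e \<union> ax4_e)"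

definition S5_eq :: "fme set" where
  "S5_eq = with_AN_e (CPC_e \<union> ax1_e \<union> ax2_e \<union> ax3_e \<union> ax4_e \<union> ax5_e)"


section \<open>Translations and duality\<close>

primrec box_tr :: "fme \<Rightarrow> fmb" where
  "box_tr (EVar n) = BVar n"
| "box_tr \<bottom>\<^sub>e = \<bottom>\<^sub>b"
| "box_tr \<top>\<^sub>e = \<top>\<^sub>b"
| "box_tr (\<not>\<^sub>e p) = \<not>\<^sub>b box_tr p"
| "box_tr (p \<or>\<^sub>e q) = box_tr p \<or>\<^sub>b box_tr q"
| "box_tr (p \<and>\<^sub>e q) = box_tr p \<and>\<^sub>b box_tr q"
| "box_tr (p \<rightarrow>\<^sub>e q) = box_tr p \<rightarrow>\<^sub>b box_tr q"
| "box_tr (p \<equiv>\<^sub>e q) = \<box>\<^sub>b (box_tr p \<leftrightarrow>\<^sub>b box_tr q)"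

primrec id_tr :: "fmb \<Rightarrow> fme" where
  "id_tr (BVar n) = EVar n"
| "id_tr \<bottom>\<^sub>b = \<bottom>\<^sub>e"
| "id_tr \<top>\<^sub>b = \<top>\<^sub>e"
| "id_tr (\<not>\<^sub>b p) = \<not>\<^sub>e id_tr p"
| "id_tr (p \<or>\<^sub>b q) = id_tr p \<or>\<^sub>e id_tr q"
| "id_tr (p \<and>\<^sub>b q) = id_tr p \<and>\<^sub>e id_tr q"
| "id_tr (p \<rightarrow>\<^sub>b q) = id_tr p \<rightarrow>\<^sub>e id_tr q"
| "id_tr (\<box>\<^sub>b p) = id_tr p \<equiv>\<^sub>e \<top>\<^sub>e"

text \<open>The first three conjuncts are the prerequisites on the pair of logics; the
  disjunction is the duality condition proper.\<close>

definition dual_SCI_theory :: "fme set \<Rightarrow> fmb set \<Rightarrow> bool" where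
  "dual_SCI_theory Le L \<longleftrightarrow>
     (\<forall>H p. H \<turnstile>\<^sub>b[S1SP] p \<longrightarrow> H \<turnstile>\<^sub>b[L] p) \<and>
     (\<forall>H p. H \<turnstile>\<^sub>e[SCI] p \<longrightarrow> H \<turnstile>\<^sub>e[Le] p) \<and>
     (\<forall>p q. {} \<turnstile>\<^sub>e[Le] (p \<equiv>\<^sub>e q) \<equiv>\<^sub>e \<box>\<^sub>e (p \<leftrightarrow>\<^sub>e q)) \<and>
     ((\<forall>H p. H \<turnstile>\<^sub>e[Le] p \<longleftrightarrow> box_tr ` H \<turnstile>\<^sub>b[L] box_tr p) \<or>
      (\<forall>H p. H \<turnstile>\<^sub>b[L] p \<longleftrightarrow> id_tr ` H \<turnstile>\<^sub>e[Le] id_tr p))"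

end

theory Submission
  imports Defs "HOL-Library.Countable"
begin

text \<open>Condition (ii) of duality is the one that holds most directly.  Every system here proves
  K and is closed under replacement of strict equivalents, so in it every formula \<open>\<box>A\<close> is strictly
  equivalent to \<open>\<box>(A \<leftrightarrow> \<top>)\<close>, which is what \<open>box \<circ> id\<close> makes of a box.  Hence \<open>box (id p)\<close> is
  provably strictly equivalent to \<open>p\<close>, and it suffices that each translation sends axioms to
  theorems: then \<open>id \<Phi> \<turnstile> id \<phi>\<close> gives \<open>box (id \<Phi>) \<turnstile> box (id \<phi>)\<close>, that is, \<open>\<Phi> \<turnstile> \<phi>\<close>.\<close>

section \<open>Closure under Modus Ponens\<close>

text \<open>Derivability without sequences, so that rule induction becomes available.\<close>

inductive_set mp_closure :: "('f \<Rightarrow> 'f \<Rightarrow> 'f) \<Rightarrow> 'f set \<Rightarrow> 'f set" for imp G where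
  base: "p \<in> G \<Longrightarrow> p \<in> mp_closure imp G"
| mp: "imp p q \<in> mp_closure imp G \<Longrightarrow> p \<in> mp_closure imp G \<Longrightarrow> q \<in> mp_closure imp G"

text \<open>Justifications refer only to smaller indices, so extending a sequence at its end leaves
  the conditions on the old members unchanged.\<close>

lemma derivation_snoc:
  "derivation imp G (ps @ [q]) \<longleftrightarrow>
     derivation imp G ps \<and> (q \<in> G \<or> (\<exists>p \<in> set ps. imp p q \<in> set ps))"
proof -
  let ?R = "\<lambda>ps i. ps ! i \<in> G \<or> (\<exists>j<i. \<exists>k<i. ps ! k = imp (ps ! j) (ps ! i))"
  have "?R (ps @ [q]) i \<longleftrightarrow> ?R ps i" if "i < length ps" for i
    using that by (simp add: nth_append cong: conj_cong)
  moreover have "?R (ps @ [q]) (length ps) \<longleftrightarrow> q \<in> G \<or> (\<exists>p \<in> set ps. imp p q \<in> set ps)"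
    by (simp add: nth_append Bex_def in_set_conv_nth cong: conj_cong) metis
  ultimately show ?thesis
    unfolding derivation_def by (simp add: All_less_Suc conj_commute)
qed

lemma derivation_append:
  assumes "derivation imp G ps" and "derivation imp G qs"
  shows "derivation imp G (ps @ qs)"
  using assms(2)
proof (induction qs rule: rev_induct)
  case (snoc q qs)
  then show ?case
    by (auto simp: derivation_snoc simp flip: append_assoc)
qed (use assms in simp)

text \<open>From left to right by strong induction on the position in the sequence. Conversely,
  derivations of the two premises are concatenated and the conclusion is appended.\<close>

lemma derivation_iff_mp_closure:
  "(\<exists>ps. ps \<noteq> [] \<and> last ps = p \<and> derivation imp G ps) \<longleftrightarrow> p \<in> mp_closure imp G"
proof
  assume "\<exists>ps. ps \<noteq> [] \<and> last ps = p \<and> derivation imp G ps"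
  then obtain ps where ps: "ps \<noteq> []" "last ps = p" "derivation imp G ps" by blast
  have "i < length ps \<Longrightarrow> ps ! i \<in> mp_closure imp G" for i
  proof (induction i rule: less_induct)
    case (less i)
    then consider "ps ! i \<in> G" | j k where "j < i" "k < i" "ps ! k = imp (ps ! j) (ps ! i)"
      using ps(3) unfolding derivation_def by blast
    then show ?case
    proof cases
      case 2
      then have "ps ! j \<in> mp_closure imp G" "ps ! k \<in> mp_closure imp G"
        using less.IH less.prems less_trans 2(1,2) by blast+
      with 2 show ?thesis by (metis mp_closure.mp)
    qed (rule mp_closure.base)
  qed
  then show "p \<in> mp_closure imp G"
    using ps by (metis diff_less last_conv_nth length_greater_0_conv zero_less_one)
next
  assume "p \<in> mp_closure imp G"
  then show "\<exists>ps. ps \<noteq> [] \<and> last ps = p \<and> derivation imp G ps"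
  proof induction
    case (base p)
    then show ?case by (intro exI[of _ "[p]"]) (simp add: derivation_def)
  next
    case (mp p q)
    then obtain ps qs where
      *: "ps \<noteq> []" "last ps = imp p q" "derivation imp G ps"
         "qs \<noteq> []" "last qs = p" "derivation imp G qs" by blast
    have "imp p q \<in> set ps" "p \<in> set qs"
      using * last_in_set by metis+
    then have "derivation imp G ((ps @ qs) @ [q])"
      using * by (auto simp: derivation_snoc intro: derivation_append simp del: append_assoc)
    then show ?case by (intro exI[of _ "(ps @ qs) @ [q]"]) simp
  qed
qed

lemma derives_e_iff: "H \<turnstile>\<^sub>e[L] p \<longleftrightarrow> p \<in> mp_closure EImp (H \<union> L)"
  unfolding derives_e_def derivation_iff_mp_closure ..

lemma derives_b_iff: "H \<turnstile>\<^sub>b[L] p \<longleftrightarrow> p \<in> mp_closure BImp (H \<union> L)"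
  unfolding derives_b_def derivation_iff_mp_closure ..

lemma mp_closure_mono: "p \<in> mp_closure imp G \<Longrightarrow> G \<subseteq> G' \<Longrightarrow> p \<in> mp_closure imp G'"
  by (induction rule: mp_closure.induct) (auto intro: mp_closure.intros)

text \<open>Serves both translations and, with the identity map as \<open>f\<close>, also the
  comparison of two logics in one language.\<close>

lemma mp_closure_translate:
  assumes "p \<in> mp_closure imp G"
    and "\<And>p q. f (imp p q) = imp' (f p) (f q)"
    and "\<And>p. p \<in> G \<Longrightarrow> f p \<in> mp_closure imp' G'"
  shows "f p \<in> mp_closure imp' G'"
  using assms(1)
  by induction (auto simp: assms(2) intro: assms(3) mp_closure.mp)

section \<open>Strict logics\<close>

text \<open>Only the classical connectives are constrained: variables and formulas headed by a box
  or an identity behave as atoms. The operations are parameters so that both languages share the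
  notion.\<close>

definition truth_assignment where
  "truth_assignment fls tru neg dis con imp v \<longleftrightarrow>
     \<not> v fls \<and> v tru \<and> (\<forall>p. v (neg p) \<longleftrightarrow> \<not> v p) \<and>
     (\<forall>p q. v (dis p q) \<longleftrightarrow> v p \<or> v q) \<and> (\<forall>p q. v (con p q) \<longleftrightarrow> v p \<and> v q) \<and>
     (\<forall>p q. v (imp p q) \<longleftrightarrow> (v p \<longrightarrow> v q))"

text \<open>Tautologies enter semantically, so that propositional steps reduce to evaluating truth
  conditions. Necessitation is assumed for tautologies only.\<close>

locale modal_logic =
  fixes fls tru :: 'f and neg :: "'f \<Rightarrow> 'f" and dis con imp :: "'f \<Rightarrow> 'f \<Rightarrow> 'f"
    and box :: "'f \<Rightarrow> 'f" and L :: "'f set"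
  assumes valid: "(\<And>v. truth_assignment fls tru neg dis con imp v \<Longrightarrow> v p) \<Longrightarrow> p \<in> L"
    and box_valid: "(\<And>v. truth_assignment fls tru neg dis con imp v \<Longrightarrow> v p) \<Longrightarrow> box p \<in> L"
    and T: "imp (box p) p \<in> L"
begin

abbreviation "ta \<equiv> truth_assignment fls tru neg dis con imp"
abbreviation "eqv p q \<equiv> con (imp p q) (imp q p)"

definition ded :: "'f set \<Rightarrow> 'f \<Rightarrow> bool" (infix "\<turnstile>" 50) where
  "H \<turnstile> p \<longleftrightarrow> p \<in> mp_closure imp (H \<union> L)"

lemma ta_simps:
  assumes "ta v"
  shows "\<not> v fls" "v tru" "v (neg p) \<longleftrightarrow> \<not> v p" "v (dis p q) \<longleftrightarrow> v p \<or> v q"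
    "v (con p q) \<longleftrightarrow> v p \<and> v q" "v (imp p q) \<longleftrightarrow> (v p \<longrightarrow> v q)"
  using assms by (simp_all add: truth_assignment_def)

lemma ded_ax: "p \<in> L \<Longrightarrow> H \<turnstile> p"
  and ded_hyp: "p \<in> H \<Longrightarrow> H \<turnstile> p"
  unfolding ded_def by (auto intro: mp_closure.base)

lemma ded_mp: "H \<turnstile> imp p q \<Longrightarrow> H \<turnstile> p \<Longrightarrow> H \<turnstile> q"
  unfolding ded_def by (rule mp_closure.mp)

lemma ded_mono: "H \<turnstile> p \<Longrightarrow> H \<subseteq> H' \<Longrightarrow> H' \<turnstile> p"
  unfolding ded_def by (rule mp_closure_mono) auto

lemma taut0: "(\<And>v. ta v \<Longrightarrow> v p) \<Longrightarrow> H \<turnstile> p"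
  by (intro ded_ax valid)

lemma taut1: "H \<turnstile> p \<Longrightarrow> (\<And>v. ta v \<Longrightarrow> v p \<Longrightarrow> v q) \<Longrightarrow> H \<turnstile> q"
  by (rule ded_mp[of H p], rule taut0) (auto simp: ta_simps)

lemma taut2:
  "H \<turnstile> p \<Longrightarrow> H \<turnstile> q \<Longrightarrow> (\<And>v. ta v \<Longrightarrow> v p \<Longrightarrow> v q \<Longrightarrow> v r) \<Longrightarrow> H \<turnstile> r"
  by (rule ded_mp[of H q], rule taut1[of H p]) (auto simp: ta_simps)

lemma eqv_ded_iff:
  assumes "H \<turnstile> eqv p q"
  shows "H \<turnstile> p \<longleftrightarrow> H \<turnstile> q"
proof
  show "H \<turnstile> q" if "H \<turnstile> p"
    by (rule taut2[OF assms that]) (simp add: ta_simps)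
  show "H \<turnstile> p" if "H \<turnstile> q"
    by (rule taut2[OF assms that]) (simp add: ta_simps)
qed

text \<open>Modus Ponens is the only rule with premises: necessitated axioms are members of
  \<open>L\<close>, and nothing is ever necessitated under hypotheses.\<close>

lemma deduction: "insert p H \<turnstile> q \<Longrightarrow> H \<turnstile> imp p q"
  unfolding ded_def[of "insert p H"]
proof (induction rule: mp_closure.induct)
  case (base q)
  show ?case
  proof (cases "q = p")
    case True
    then show ?thesis by (intro taut0) (auto simp: ta_simps)
  next
    case False
    then have "H \<turnstile> q" using base by (auto intro: ded_ax ded_hyp)
    then show ?thesis by (rule taut1) (auto simp: ta_simps)
  qed
next
  case (mp q r)
  from mp.IH show ?case by (rule taut2) (auto simp: ta_simps)
qed

lemma box_elim: "H \<turnstile> box p \<Longrightarrow> H \<turnstile> p"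
  using T ded_ax ded_mp by blast

end

text \<open>\<open>K\<close> need only be derivable, since none of the systems lists it as an axiom.
  In spite of the name, no rule necessitating arbitrary theorems is assumed.\<close>

locale normal_logic = modal_logic +
  assumes K: "{} \<turnstile> imp (box (imp p q)) (imp (box p) (box q))"
begin

lemma box_mp: "H \<turnstile> box (imp p q) \<Longrightarrow> H \<turnstile> box p \<Longrightarrow> H \<turnstile> box q"
  using K ded_mono[of "{}" _ H] ded_mp by blast

lemma box_taut0: "(\<And>v. ta v \<Longrightarrow> v p) \<Longrightarrow> H \<turnstile> box p"
  by (intro ded_ax box_valid)

text \<open>Propositional reasoning under a box: the boxed implication is in \<open>L\<close> by
  \<open>box_valid\<close>, and \<open>K\<close> distributes the box.\<close>

lemma box_taut1: "H \<turnstile> box p \<Longrightarrow> (\<And>v. ta v \<Longrightarrow> v p \<Longrightarrow> v q) \<Longrightarrow> H \<turnstile> box q"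
  by (rule box_mp[of H p], rule box_taut0) (auto simp: ta_simps)

lemma box_taut2:
  "H \<turnstile> box p \<Longrightarrow> H \<turnstile> box q \<Longrightarrow> (\<And>v. ta v \<Longrightarrow> v p \<Longrightarrow> v q \<Longrightarrow> v r) \<Longrightarrow> H \<turnstile> box r"
  by (rule box_mp[of H q], rule box_taut1[of H p]) (auto simp: ta_simps)

lemma box_eqv_sym: "H \<turnstile> box (eqv p q) \<Longrightarrow> H \<turnstile> box (eqv q p)"
  by (erule box_taut1) (simp add: ta_simps)

lemma box_eqv_trans: "H \<turnstile> box (eqv p q) \<Longrightarrow> H \<turnstile> box (eqv q r) \<Longrightarrow> H \<turnstile> box (eqv p r)"
  by (erule (1) box_taut2) (metis ta_simps(5,6))

end

text \<open>Together with the congruence lemmas for the classical connectives,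
  \<open>box_cong\<close> gives replacement of strict equivalents.\<close>

locale strict_logic = normal_logic +
  assumes box_cong: "{} \<turnstile> imp (box (eqv p q)) (box (eqv (box p) (box q)))"
begin

lemma box_congI: "H \<turnstile> box (eqv p q) \<Longrightarrow> H \<turnstile> box (eqv (box p) (box q))"
  using box_cong ded_mono[of "{}" _ H] ded_mp by blast

lemma neg_cong: "H \<turnstile> box (eqv p q) \<Longrightarrow> H \<turnstile> box (eqv (neg p) (neg q))"
  by (erule box_taut1) (auto simp: ta_simps)

lemma binary_cong:
  assumes "H \<turnstile> box (eqv p p')" "H \<turnstile> box (eqv q q')"
  shows "H \<turnstile> box (eqv (dis p q) (dis p' q'))"
    and "H \<turnstile> box (eqv (con p q) (con p' q'))"
    and "H \<turnstile> box (eqv (imp p q) (imp p' q'))"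
  by (rule box_taut2[OF assms], auto simp: ta_simps)+

end

section \<open>Criteria for strictness\<close>

context modal_logic
begin

text \<open>The axiom boxes its own conclusion. Removing that box by \<open>T\<close> yields
  \<open>K\<close>; keeping it and using both directions of an equivalence yields
  \<open>box_cong\<close>.\<close>

lemma strict_logic_if_axiom3:
  assumes ax3: "\<And>p q. imp (box (imp p q)) (box (imp (box p) (box q))) \<in> L"
  shows "strict_logic fls tru neg dis con imp box L"
proof -
  have *: "H \<turnstile> box (imp (box p) (box q))" if "H \<turnstile> box (imp p q)" for H p q
    using that ax3 ded_ax ded_mp by blast
  interpret normal_logic fls tru neg dis con imp box L
  proof unfold_locales
    fix p q
    have "{box (imp p q)} \<turnstile> imp (box p) (box q)"
      by (rule box_elim, rule *, rule ded_hyp) simp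
    then show "{} \<turnstile> imp (box (imp p q)) (imp (box p) (box q))"
      by (rule deduction)
  qed
  show ?thesis
  proof unfold_locales
    fix p q
    let ?H = "{box (eqv p q)}"
    have "?H \<turnstile> box (eqv p q)" by (simp add: ded_hyp)
    then have "?H \<turnstile> box (imp p q)" "?H \<turnstile> box (imp q p)"
      by (rule box_taut1, force simp: ta_simps)+
    then have "?H \<turnstile> box (imp (box p) (box q))" "?H \<turnstile> box (imp (box q) (box p))"
      by (auto intro: *)
    then have "?H \<turnstile> box (eqv (box p) (box q))"
      by (rule box_taut2) (auto simp: ta_simps)
    then show "{} \<turnstile> imp (box (eqv p q)) (box (eqv (box p) (box q)))"
      by (rule deduction)
  qed
qed

text \<open>The axiom (3') is K with an antecedent; the antecedent \<open>\<top>\<close> can be introduced and removed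
  under a box by replacement.\<close>

lemma strict_logic_if_axiom3':
  assumes ax3': "\<And>p q r. imp (con (box (imp p q)) (box (imp q r))) (box (imp p r)) \<in> L"
    and cong: "\<And>p q. {} \<turnstile> imp (box (eqv p q)) (box (eqv (box p) (box q)))"
  shows "strict_logic fls tru neg dis con imp box L"
proof unfold_locales
  fix p q
  let ?H = "{box p, box (imp p q)}"
  have top_imp: "?H \<turnstile> eqv (box r) (box (imp tru r))" for r
  proof (rule box_elim, rule ded_mp)
    show "?H \<turnstile> imp (box (eqv r (imp tru r))) (box (eqv (box r) (box (imp tru r))))"
      using cong ded_mono by blast
    show "?H \<turnstile> box (eqv r (imp tru r))"
      by (intro ded_ax box_valid) (auto simp: ta_simps)
  qed
  have "?H \<turnstile> box p" "?H \<turnstile> box (imp p q)" by (auto intro: ded_hyp)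
  moreover from this(1) have "?H \<turnstile> box (imp tru p)"
    by (rule taut2[OF top_imp[of p]]) (auto simp: ta_simps)
  ultimately have "?H \<turnstile> con (box (imp tru p)) (box (imp p q))"
    by - (rule taut2, auto simp: ta_simps)
  then have "?H \<turnstile> box (imp tru q)" using ax3' ded_ax ded_mp by blast
  then have "?H \<turnstile> box q" by (rule taut2[OF top_imp[of q]]) (auto simp: ta_simps)
  then show "{} \<turnstile> imp (box (imp p q)) (imp (box p) (box q))"
    by (intro deduction)
qed (rule cong)

end

text \<open>Systems with \<open>ax3_e\<close> do not list \<open>ax3'_e\<close>, but duality also
  demands its necessitated instances. Theorems cannot be necessitated, so every step is carried out
  under a box.\<close>

lemma (in normal_logic) box_axiom3':
  assumes ax3: "\<And>p q. imp (box (imp p q)) (box (imp (box p) (box q))) \<in> L"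
    and box_ax3: "\<And>p q. box (imp (box (imp p q)) (box (imp (box p) (box q)))) \<in> L"
    and box_T: "\<And>p. box (imp (box p) p) \<in> L"
  shows "{} \<turnstile> box (imp (con (box (imp p q)) (box (imp q r))) (box (imp p r)))"
proof -
  \<comment> \<open>Boxed \<open>ax3\<close> chained with boxed \<open>T\<close> drops the inner box
    of its conclusion.\<close>
  have box_K: "{} \<turnstile> box (imp (box (imp a b)) (imp (box a) (box b)))" for a b
    by (rule box_taut2[OF ded_ax[OF box_ax3[of a b]] ded_ax[OF box_T[of "imp (box a) (box b)"]]])
      (auto simp: ta_simps)
  \<comment> \<open>Transitivity is written with \<open>imp q r\<close> in front so that
    \<open>ax3\<close> can box antecedent and consequent; \<open>box_K\<close> then distributes the
    box over the consequent.\<close>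
  have "{} \<turnstile> box (imp (imp q r) (imp (imp p q) (imp p r)))"
    by (rule box_taut0) (auto simp: ta_simps)
  then have "{} \<turnstile> box (imp (box (imp q r)) (box (imp (imp p q) (imp p r))))"
    using ax3 ded_ax ded_mp by blast
  then show ?thesis
    by (rule box_taut2[OF box_K[of "imp p q" "imp p r"]]) (auto simp: ta_simps)
qed

section \<open>The two languages\<close>

instance fme :: countable by countable_datatype
instance fmb :: countable by countable_datatype

text \<open>Identities become classical variables. Object variables are coded through
  \<open>to_nat\<close> as well, so that their codes cannot clash with those of identities;
  \<open>from_nat\<close> undoes the coding.\<close>

primrec skeleton_e :: "fme \<Rightarrow> cfm" where
  "skeleton_e (EVar n) = CVar (to_nat (EVar n))"
| "skeleton_e \<bottom>\<^sub>e = CBot"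
| "skeleton_e \<top>\<^sub>e = CTop"
| "skeleton_e (\<not>\<^sub>e p) = CNeg (skeleton_e p)"
| "skeleton_e (p \<or>\<^sub>e q) = COr (skeleton_e p) (skeleton_e q)"
| "skeleton_e (p \<and>\<^sub>e q) = CAnd (skeleton_e p) (skeleton_e q)"
| "skeleton_e (p \<rightarrow>\<^sub>e q) = CImp (skeleton_e p) (skeleton_e q)"
| "skeleton_e (p \<equiv>\<^sub>e q) = CVar (to_nat (p \<equiv>\<^sub>e q))"

primrec skeleton_b :: "fmb \<Rightarrow> cfm" where
  "skeleton_b (BVar n) = CVar (to_nat (BVar n))"
| "skeleton_b \<bottom>\<^sub>b = CBot"
| "skeleton_b \<top>\<^sub>b = CTop"
| "skeleton_b (\<not>\<^sub>b p) = CNeg (skeleton_b p)"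
| "skeleton_b (p \<or>\<^sub>b q) = COr (skeleton_b p) (skeleton_b q)"
| "skeleton_b (p \<and>\<^sub>b q) = CAnd (skeleton_b p) (skeleton_b q)"
| "skeleton_b (p \<rightarrow>\<^sub>b q) = CImp (skeleton_b p) (skeleton_b q)"
| "skeleton_b (\<box>\<^sub>b p) = CVar (to_nat (\<box>\<^sub>b p))"

text \<open>Every valuation of the skeleton induces a truth assignment on formulas, so the skeleton
  is a tautology, and \<open>p\<close> is its instance under \<open>from_nat\<close>.\<close>

lemma CPC_eI:
  assumes "\<And>v. truth_assignment EBot ETop ENeg EOr EAnd EImp v \<Longrightarrow> v p"
  shows "p \<in> CPC_e"
proof -
  have "cinst_e from_nat (skeleton_e p) = p"
    by (induction p) auto
  moreover have "ceval v (skeleton_e p)" for v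
  proof (rule assms)
    show "truth_assignment EBot ETop ENeg EOr EAnd EImp (\<lambda>p. ceval v (skeleton_e p))"
      by (simp add: truth_assignment_def)
  qed
  ultimately have "p = cinst_e from_nat (skeleton_e p) \<and> tautology (skeleton_e p)"
    by (simp add: tautology_def)
  then show ?thesis unfolding CPC_e_def by (intro CollectI exI)
qed

lemma CPC_bI:
  assumes "\<And>v. truth_assignment BBot BTop BNeg BOr BAnd BImp v \<Longrightarrow> v p"
  shows "p \<in> CPC_b"
proof -
  have "cinst_b from_nat (skeleton_b p) = p"
    by (induction p) auto
  moreover have "ceval v (skeleton_b p)" for v
  proof (rule assms)
    show "truth_assignment BBot BTop BNeg BOr BAnd BImp (\<lambda>p. ceval v (skeleton_b p))"
      by (simp add: truth_assignment_def)
  qed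
  ultimately have "p = cinst_b from_nat (skeleton_b p) \<and> tautology (skeleton_b p)"
    by (simp add: tautology_def)
  then show ?thesis unfolding CPC_b_def by (intro CollectI exI)
qed

abbreviation "modal_e \<equiv> modal_logic EBot ETop ENeg EOr EAnd EImp EBox"
abbreviation "modal_b \<equiv> modal_logic BBot BTop BNeg BOr BAnd BImp BBox"
abbreviation "strict_e \<equiv> strict_logic EBot ETop ENeg EOr EAnd EImp EBox"
abbreviation "strict_b \<equiv> strict_logic BBot BTop BNeg BOr BAnd BImp BBox"

lemma modal_eI:
  assumes "with_AN_e (CPC_e \<union> ax2_e) \<subseteq> L"
  shows "modal_e L"
proof unfold_locales
  fix p assume *: "\<And>v. truth_assignment EBot ETop ENeg EOr EAnd EImp v \<Longrightarrow> v p"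
  have "p \<in> CPC_e" by (rule CPC_eI) (rule *)
  then show "p \<in> L" "\<box>\<^sub>e p \<in> L"
    using assms by (auto simp: with_AN_e_def)
qed (use assms in \<open>auto simp: with_AN_e_def ax2_e_def\<close>)

lemma modal_bI:
  assumes "with_AN_b (CPC_b \<union> ax2_b) \<subseteq> L"
  shows "modal_b L"
proof unfold_locales
  fix p assume *: "\<And>v. truth_assignment BBot BTop BNeg BOr BAnd BImp v \<Longrightarrow> v p"
  have "p \<in> CPC_b" by (rule CPC_bI) (rule *)
  then show "p \<in> L" "\<box>\<^sub>b p \<in> L"
    using assms by (auto simp: with_AN_b_def)
qed (use assms in \<open>auto simp: with_AN_b_def ax2_b_def\<close>)

section \<open>Logics of identity and SCI inside them\<close>

locale identity_logic = strict_logic EBot ETop ENeg EOr EAnd EImp EBox L for L +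
  assumes ax1: "with_AN_e ax1_e \<subseteq> L"
begin

notation ded (infix "\<turnstile>" 50)

lemma box_ax1: "H \<turnstile> \<box>\<^sub>e ((p \<equiv>\<^sub>e q) \<leftrightarrow>\<^sub>e \<box>\<^sub>e (p \<leftrightarrow>\<^sub>e q))"
  using ax1 by (intro ded_ax) (auto simp: with_AN_e_def ax1_e_def)

lemma identity_iff: "H \<turnstile> p \<equiv>\<^sub>e q \<longleftrightarrow> H \<turnstile> \<box>\<^sub>e (p \<leftrightarrow>\<^sub>e q)"
proof -
  have "H \<turnstile> (p \<equiv>\<^sub>e q) \<leftrightarrow>\<^sub>e \<box>\<^sub>e (p \<leftrightarrow>\<^sub>e q)"
    by (rule box_elim[OF box_ax1])
  then show ?thesis by (rule eqv_ded_iff)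
qed

text \<open>Boxed \<open>ax1\<close> exchanges an identity for a boxed biconditional, where
  replacement under the box applies; transitivity leads back.\<close>

lemma identity_cong:
  assumes "H \<turnstile> \<box>\<^sub>e (p \<leftrightarrow>\<^sub>e p')" "H \<turnstile> \<box>\<^sub>e (q \<leftrightarrow>\<^sub>e q')"
  shows "H \<turnstile> \<box>\<^sub>e ((p \<equiv>\<^sub>e q) \<leftrightarrow>\<^sub>e (p' \<equiv>\<^sub>e q'))"
proof -
  have "H \<turnstile> \<box>\<^sub>e ((p \<leftrightarrow>\<^sub>e q) \<leftrightarrow>\<^sub>e (p' \<leftrightarrow>\<^sub>e q'))"
    by (rule binary_cong(2)[OF binary_cong(3)[OF assms] binary_cong(3)[OF assms(2,1)]])
  then have "H \<turnstile> \<box>\<^sub>e (\<box>\<^sub>e (p \<leftrightarrow>\<^sub>e q) \<leftrightarrow>\<^sub>e \<box>\<^sub>e (p' \<leftrightarrow>\<^sub>e q'))"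
    by (rule box_congI)
  from box_eqv_trans[OF box_ax1 this] box_eqv_sym[OF box_ax1] show ?thesis
    by (rule box_eqv_trans)
qed

lemma identity_binary_cong:
  assumes "f \<in> {EOr, EAnd, EImp, EId}" "H \<turnstile> p \<equiv>\<^sub>e p'" "H \<turnstile> q \<equiv>\<^sub>e q'"
  shows "H \<turnstile> f p q \<equiv>\<^sub>e f p' q'"
proof -
  have "H \<turnstile> \<box>\<^sub>e (p \<leftrightarrow>\<^sub>e p')" "H \<turnstile> \<box>\<^sub>e (q \<leftrightarrow>\<^sub>e q')"
    using assms identity_iff by blast+
  note binary_cong[OF this] identity_cong[OF this]
  then have "H \<turnstile> \<box>\<^sub>e (f p q \<leftrightarrow>\<^sub>e f p' q')"
    using assms(1) by blast
  then show ?thesis by (rule identity_iff[THEN iffD2])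
qed

lemma SCI_theorems:
  assumes "p \<in> SCI"
  shows "H \<turnstile> p"
proof -
  \<comment> \<open>\<open>L\<close> is only known to contain the formulas true under all truth
    assignments. A tautology instance is one of them, since \<open>v\<close> composed with the
    substitution is a valuation of the classical formula.\<close>
  have "H \<turnstile> p" if "p \<in> CPC_e"
  proof (rule taut0)
    fix v assume v: "ta v"
    from that obtain s t where p: "p = cinst_e s t" and t: "tautology t"
      unfolding CPC_e_def by blast
    have "v (cinst_e s c) = ceval (\<lambda>n. v (s n)) c" for c
      using v by (induction c) (auto simp: ta_simps)
    with p t show "v p" by (simp add: tautology_def)
  qed
  moreover have "H \<turnstile> p \<equiv>\<^sub>e p" for p
    by (rule identity_iff[THEN iffD2], rule box_taut0) (auto simp: ta_simps)
  moreover have "H \<turnstile> (p \<equiv>\<^sub>e q) \<rightarrow>\<^sub>e (p \<rightarrow>\<^sub>e q)" for p q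
  proof (rule deduction)
    have "insert (p \<equiv>\<^sub>e q) H \<turnstile> p \<leftrightarrow>\<^sub>e q"
      by (rule box_elim, rule identity_iff[THEN iffD1], rule ded_hyp) simp
    then show "insert (p \<equiv>\<^sub>e q) H \<turnstile> p \<rightarrow>\<^sub>e q"
      by (rule taut1) (auto simp: ta_simps)
  qed
  moreover have "H \<turnstile> (p \<equiv>\<^sub>e q) \<rightarrow>\<^sub>e ((\<not>\<^sub>e p) \<equiv>\<^sub>e (\<not>\<^sub>e q))" for p q
    by (rule deduction, rule identity_iff[THEN iffD2], rule neg_cong,
        rule identity_iff[THEN iffD1], rule ded_hyp) simp
  moreover have "H \<turnstile> ((p1 \<equiv>\<^sub>e q1) \<and>\<^sub>e (p2 \<equiv>\<^sub>e q2)) \<rightarrow>\<^sub>e (f p1 p2 \<equiv>\<^sub>e f q1 q2)"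
    if "f \<in> {EOr, EAnd, EImp, EId}" for f p1 q1 p2 q2
  proof (rule deduction)
    let ?H = "insert ((p1 \<equiv>\<^sub>e q1) \<and>\<^sub>e (p2 \<equiv>\<^sub>e q2)) H"
    have "?H \<turnstile> (p1 \<equiv>\<^sub>e q1) \<and>\<^sub>e (p2 \<equiv>\<^sub>e q2)" by (simp add: ded_hyp)
    then have "?H \<turnstile> p1 \<equiv>\<^sub>e q1" "?H \<turnstile> p2 \<equiv>\<^sub>e q2"
      by (rule taut1, auto simp: ta_simps)+
    then show "?H \<turnstile> f p1 p2 \<equiv>\<^sub>e f q1 q2"
      by (rule identity_binary_cong[OF that])
  qed
  ultimately show ?thesis
    using assms unfolding SCI_def by blast
qed

end

section \<open>Strictness of the individual systems\<close>

lemma identity_logic_S3: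
  assumes "with_AN_e (CPC_e \<union> ax1_e \<union> ax2_e \<union> ax3_e) \<subseteq> L"
  shows "identity_logic L"
proof -
  interpret modal_logic EBot ETop ENeg EOr EAnd EImp EBox L
    using assms by (intro modal_eI) (auto simp: with_AN_e_def)
  interpret strict_logic EBot ETop ENeg EOr EAnd EImp EBox L
    using assms by (intro strict_logic_if_axiom3) (auto simp: with_AN_e_def ax3_e_def)
  show ?thesis
    using assms by unfold_locales (auto simp: with_AN_e_def)
qed

lemma identity_logic_S1SP: "identity_logic S1SP_eq"
proof -
  interpret modal_logic EBot ETop ENeg EOr EAnd EImp EBox S1SP_eq
    by (rule modal_eI) (auto simp: with_AN_e_def S1SP_eq_def)
  write ded (infix "\<turnstile>" 50)
  have ax1: "with_AN_e ax1_e \<subseteq> S1SP_eq" by (auto simp: with_AN_e_def S1SP_eq_def)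
  \<comment> \<open>This repeats \<open>identity_iff\<close>, because the locale that supplies it is
    only being established.\<close>
  have ident: "H \<turnstile> p \<equiv>\<^sub>e q \<longleftrightarrow> H \<turnstile> \<box>\<^sub>e (p \<leftrightarrow>\<^sub>e q)" for H p q
  proof -
    have "H \<turnstile> (p \<equiv>\<^sub>e q) \<leftrightarrow>\<^sub>e \<box>\<^sub>e (p \<leftrightarrow>\<^sub>e q)"
      using ax1 by (intro ded_ax) (auto simp: with_AN_e_def ax1_e_def)
    then show ?thesis by (rule eqv_ded_iff)
  qed
  have "strict_e S1SP_eq"
  proof (rule strict_logic_if_axiom3')
    fix p q
    let ?H = "{\<box>\<^sub>e (p \<leftrightarrow>\<^sub>e q)}"
    \<comment> \<open>With this context SP speaks about boxes; \<open>ident\<close> passes between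
      the identities of SP and boxed biconditionals.\<close>
    have "subst_e (EVar 0 \<equiv>\<^sub>e \<top>\<^sub>e) 0 r = \<box>\<^sub>e r" for r by simp
    then have "(p \<equiv>\<^sub>e q) \<rightarrow>\<^sub>e (\<box>\<^sub>e p \<equiv>\<^sub>e \<box>\<^sub>e q) \<in> SP_e"
      unfolding SP_e_def by (metis (mono_tags, lifting) mem_Collect_eq)
    then have "?H \<turnstile> (p \<equiv>\<^sub>e q) \<rightarrow>\<^sub>e (\<box>\<^sub>e p \<equiv>\<^sub>e \<box>\<^sub>e q)"
      by (intro ded_ax) (simp add: S1SP_eq_def)
    moreover have "?H \<turnstile> p \<equiv>\<^sub>e q"
      by (rule ident[THEN iffD2], rule ded_hyp) simp
    ultimately have "?H \<turnstile> \<box>\<^sub>e p \<equiv>\<^sub>e \<box>\<^sub>e q" by (rule ded_mp)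
    then show "{} \<turnstile> \<box>\<^sub>e (p \<leftrightarrow>\<^sub>e q) \<rightarrow>\<^sub>e \<box>\<^sub>e (\<box>\<^sub>e p \<leftrightarrow>\<^sub>e \<box>\<^sub>e q)"
      by (rule deduction[OF ident[THEN iffD1]])
  qed (auto simp: S1SP_eq_def with_AN_e_def ax3'_e_def)
  then show ?thesis
    using ax1 by (intro identity_logic.intro) (auto simp: identity_logic_axioms_def)
qed

lemma strict_b_S3:
  assumes "with_AN_b (CPC_b \<union> ax2_b \<union> ax3_b) \<subseteq> L"
  shows "strict_b L"
proof -
  interpret modal_logic BBot BTop BNeg BOr BAnd BImp BBox L
    using assms by (intro modal_bI) (auto simp: with_AN_b_def)
  show ?thesis
    using assms by (intro strict_logic_if_axiom3) (auto simp: with_AN_b_def ax3_b_def)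
qed

text \<open>Identity here abbreviates the boxed biconditional, so SP with a boxed variable as
  context is literally \<open>box_cong\<close>.\<close>

lemma strict_b_S1SP: "strict_b S1SP"
proof -
  interpret modal_logic BBot BTop BNeg BOr BAnd BImp BBox S1SP
    by (rule modal_bI) (auto simp: with_AN_b_def S1SP_def)
  write ded (infix "\<turnstile>" 50)
  show ?thesis
  proof (rule strict_logic_if_axiom3')
    fix p q
    have "subst_b (\<box>\<^sub>b BVar 0) 0 r = \<box>\<^sub>b r" for r by simp
    then have "(p \<equiv>\<^sub>b q) \<rightarrow>\<^sub>b (\<box>\<^sub>b p \<equiv>\<^sub>b \<box>\<^sub>b q) \<in> SP_b"
      unfolding SP_b_def by (metis (mono_tags, lifting) mem_Collect_eq)
    then show "{} \<turnstile> (p \<equiv>\<^sub>b q) \<rightarrow>\<^sub>b (\<box>\<^sub>b p \<equiv>\<^sub>b \<box>\<^sub>b q)"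
      by (intro ded_ax) (simp add: S1SP_def)
  qed (auto simp: S1SP_def with_AN_b_def ax3'_b_def)
qed

section \<open>Duality\<close>

text \<open>Shortens some boxed biconditionals with \<open>BTop\<close> to plain boxes. A relation
  rather than a function, because a formula may contain such biconditionals that have to
  stay.\<close>

inductive collapse :: "fmb \<Rightarrow> fmb \<Rightarrow> bool" where
  collapse_refl: "collapse p p"
| collapse_neg: "collapse p p' \<Longrightarrow> collapse (\<not>\<^sub>b p) (\<not>\<^sub>b p')"
| collapse_or: "collapse p p' \<Longrightarrow> collapse q q' \<Longrightarrow> collapse (p \<or>\<^sub>b q) (p' \<or>\<^sub>b q')"
| collapse_and: "collapse p p' \<Longrightarrow> collapse q q' \<Longrightarrow> collapse (p \<and>\<^sub>b q) (p' \<and>\<^sub>b q')"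
| collapse_imp: "collapse p p' \<Longrightarrow> collapse q q' \<Longrightarrow> collapse (p \<rightarrow>\<^sub>b q) (p' \<rightarrow>\<^sub>b q')"
| collapse_box: "collapse p p' \<Longrightarrow> collapse (\<box>\<^sub>b (p \<leftrightarrow>\<^sub>b \<top>\<^sub>b)) (\<box>\<^sub>b p')"

lemmas collapse_intros =
  collapse_box collapse_neg collapse_or collapse_and collapse_imp collapse_refl

lemma collapse_box_id: "collapse (box_tr (id_tr p)) p"
  by (induction p) (auto intro: collapse_intros)

locale box_logic = strict_logic BBot BTop BNeg BOr BAnd BImp BBox L for L
begin

notation ded (infix "\<turnstile>" 50)

lemma collapse_equiv: "collapse p q \<Longrightarrow> H \<turnstile> p \<equiv>\<^sub>b q"
proof (induction rule: collapse.induct)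
  case (collapse_refl p)
  then show ?case by (intro box_taut0) (auto simp: ta_simps)
next
  case (collapse_box p p')
  \<comment> \<open>The biconditional of \<open>p\<close> with \<open>BTop\<close> is
    propositionally equivalent to \<open>p\<close>, so it may take the place of \<open>p\<close>
    under the box.\<close>
  from collapse_box.IH have "H \<turnstile> \<box>\<^sub>b ((p \<leftrightarrow>\<^sub>b \<top>\<^sub>b) \<leftrightarrow>\<^sub>b p')"
    by (rule box_taut1) (auto simp: ta_simps)
  then show ?case by (rule box_congI)
qed (auto intro: neg_cong binary_cong)

lemma collapse_ded_iff:
  assumes "collapse p q"
  shows "H \<turnstile> p \<longleftrightarrow> H \<turnstile> q"
  by (rule eqv_ded_iff[OF box_elim[OF collapse_equiv[OF assms]]])

text \<open>A translated axiom is only strictly equivalent to a modal axiom \<open>M\<close>, so its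
  box is obtained from the boxed \<open>M\<close>. A necessitated axiom is an identity with
  \<open>ETop\<close>, whose translation follows from that box.\<close>

lemma box_tr_with_AN:
  assumes "A \<in> with_AN_e Ax"
    and "\<And>A. A \<in> Ax \<Longrightarrow> \<exists>M. collapse (box_tr A) M \<and> \<box>\<^sub>b M \<in> L"
  shows "{} \<turnstile> box_tr A"
proof -
  have *: "{} \<turnstile> \<box>\<^sub>b (box_tr A)" if A: "A \<in> Ax" for A
  proof -
    from assms(2)[OF A] obtain M where M: "collapse (box_tr A) M" "\<box>\<^sub>b M \<in> L" by blast
    show ?thesis
      by (rule box_taut2[OF collapse_equiv[OF M(1)] ded_ax[OF M(2)]]) (auto simp: ta_simps)
  qed
  moreover have "{} \<turnstile> \<box>\<^sub>b (box_tr A \<leftrightarrow>\<^sub>b \<top>\<^sub>b)" if "A \<in> Ax" for A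
    by (rule box_taut1[OF *[OF that]]) (auto simp: ta_simps)
  ultimately show ?thesis
    using assms(1) box_elim by (auto simp: with_AN_e_def)
qed

text \<open>Congruence of all connectives lifts to arbitrary contexts by induction on
  \<open>c\<close>. This places \<open>S1SP\<close> inside the systems based on
  \<open>ax3_b\<close>.\<close>

lemma SP_theorems:
  assumes "p \<in> SP_b"
  shows "H \<turnstile> p"
proof -
  have "insert (p \<equiv>\<^sub>b q) H \<turnstile> subst_b c x p \<equiv>\<^sub>b subst_b c x q" for p q c x
  proof (induction c)
    case (BVar n)
    then show ?case
      by (auto intro: ded_hyp box_taut0 simp: ta_simps)
  qed (auto intro: neg_cong binary_cong box_congI box_taut0 simp: ta_simps)
  then show ?thesis
    using assms by (auto simp: SP_b_def intro: deduction)
qed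

end

text \<open>The disjunct with \<open>id_tr\<close> is established. The hypotheses concern only
  formulas entered without premises, since \<open>mp_closure_translate\<close> extends them to
  derivations.\<close>

lemma dual_SCI_theoryI:
  assumes "identity_logic Le" and "strict_b L"
    and sub: "\<And>p. p \<in> S1SP \<Longrightarrow> {} \<turnstile>\<^sub>b[L] p"
    and box: "\<And>p. p \<in> Le \<Longrightarrow> {} \<turnstile>\<^sub>b[L] box_tr p"
    and id: "\<And>p. p \<in> L \<Longrightarrow> {} \<turnstile>\<^sub>e[Le] id_tr p"
  shows "dual_SCI_theory Le L"
proof -
  interpret e: identity_logic Le by fact
  interpret b: box_logic L using assms(2) by (rule box_logic.intro)
  have ded_e: "H \<turnstile>\<^sub>e[Le] p \<longleftrightarrow> e.ded H p" for H p
    unfolding derives_e_iff e.ded_def ..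
  have ded_b: "H \<turnstile>\<^sub>b[L] p \<longleftrightarrow> b.ded H p" for H p
    unfolding derives_b_iff b.ded_def ..
  have "H \<turnstile>\<^sub>b[L] p" if "H \<turnstile>\<^sub>b[S1SP] p" for H p
    using that sub b.ded_mono[of "{}" _ H] unfolding derives_b_iff[of H S1SP] ded_b b.ded_def
    by (elim mp_closure_translate[where f = "\<lambda>p. p"]) (auto intro: mp_closure.base)
  moreover have "H \<turnstile>\<^sub>e[Le] p" if "H \<turnstile>\<^sub>e[SCI] p" for H p
    using that e.SCI_theorems[of _ H] unfolding derives_e_iff e.ded_def
    by (elim mp_closure_translate[where f = "\<lambda>p. p"]) (auto intro: mp_closure.base)
  moreover have "{} \<turnstile>\<^sub>e[Le] (p \<equiv>\<^sub>e q) \<equiv>\<^sub>e \<box>\<^sub>e (p \<leftrightarrow>\<^sub>e q)" for p q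
    unfolding ded_e by (rule e.identity_iff[THEN iffD2], rule e.box_ax1)
  moreover have "H \<turnstile>\<^sub>b[L] p \<longleftrightarrow> id_tr ` H \<turnstile>\<^sub>e[Le] id_tr p" for H p
  proof
    assume "H \<turnstile>\<^sub>b[L] p"
    then show "id_tr ` H \<turnstile>\<^sub>e[Le] id_tr p"
      using id e.ded_mono[of "{}" _ "id_tr ` H"] unfolding derives_b_iff ded_e e.ded_def
      by (elim mp_closure_translate) (auto intro: mp_closure.base)
  next
    assume *: "id_tr ` H \<turnstile>\<^sub>e[Le] id_tr p"
    have "b.ded H (box_tr (id_tr p))"
      unfolding b.ded_def
    proof (rule mp_closure_translate[OF *[unfolded derives_e_iff]])
      fix q assume "q \<in> id_tr ` H \<union> Le"
      \<comment> \<open>If \<open>q\<close> is a translated hypothesis, collapsing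
        \<open>box_tr q\<close> recovers the original member of \<open>H\<close>.\<close>
      then have "b.ded H (box_tr q)"
        using box b.ded_mono[of "{}" _ H] b.collapse_ded_iff[OF collapse_box_id] b.ded_hyp
        unfolding ded_b by blast
      then show "box_tr q \<in> mp_closure BImp (H \<union> L)" by (simp add: b.ded_def)
    qed simp
    then show "H \<turnstile>\<^sub>b[L] p"
      using b.collapse_ded_iff[OF collapse_box_id] unfolding ded_b by blast
  qed
  ultimately show ?thesis
    unfolding dual_SCI_theory_def by blast
qed

section \<open>Images of the axiom schemes under the translations\<close>

lemma id_tr_cinst: "id_tr (cinst_b s t) = cinst_e (id_tr \<circ> s) t"
  by (induction t) auto

lemma box_tr_cinst: "box_tr (cinst_e s t) = cinst_b (box_tr \<circ> s) t"
  by (induction t) auto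

lemma id_tr_subst: "id_tr (subst_b c x p) = subst_e (id_tr c) x (id_tr p)"
  by (induction c) auto

lemma box_tr_subst: "box_tr (subst_e c x p) = subst_b (box_tr c) x (box_tr p)"
  by (induction c) auto

lemma id_tr_axioms:
  "p \<in> CPC_b \<Longrightarrow> id_tr p \<in> CPC_e"
  "p \<in> ax2_b \<Longrightarrow> id_tr p \<in> ax2_e"
  "p \<in> ax3'_b \<Longrightarrow> id_tr p \<in> ax3'_e"
  "p \<in> ax3_b \<Longrightarrow> id_tr p \<in> ax3_e"
  "p \<in> ax4_b \<Longrightarrow> id_tr p \<in> ax4_e"
  "p \<in> ax5_b \<Longrightarrow> id_tr p \<in> ax5_e"
  using id_tr_cinst
  by (fastforce simp: CPC_b_def CPC_e_def ax2_b_def ax2_e_def ax3'_b_def ax3'_e_def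
      ax3_b_def ax3_e_def ax4_b_def ax4_e_def ax5_b_def ax5_e_def)+

lemma box_tr_CPC: "p \<in> CPC_e \<Longrightarrow> \<exists>M \<in> CPC_b. collapse (box_tr p) M"
  unfolding CPC_e_def CPC_b_def using box_tr_cinst collapse_refl by fastforce

text \<open>The translation of the right-hand side collapses to that of the left-hand side, so the
  axiom becomes a biconditional of a formula with itself.\<close>

lemma box_tr_ax1:
  assumes "p \<in> ax1_e"
  shows "\<exists>M \<in> CPC_b. collapse (box_tr p) M"
proof -
  obtain q r where p: "p = (q \<equiv>\<^sub>e r) \<leftrightarrow>\<^sub>e \<box>\<^sub>e (q \<leftrightarrow>\<^sub>e r)"
    using assms unfolding ax1_e_def by blast
  let ?X = "\<box>\<^sub>b (box_tr q \<leftrightarrow>\<^sub>b box_tr r)"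
  have "collapse (box_tr p) (?X \<leftrightarrow>\<^sub>b ?X)"
    unfolding p by (auto intro: collapse_intros)
  moreover have "?X \<leftrightarrow>\<^sub>b ?X \<in> CPC_b"
    by (rule CPC_bI) (auto simp: truth_assignment_def)
  ultimately show ?thesis by blast
qed

text \<open>A translated box is a boxed biconditional with \<open>BTop\<close>, so the modal axiom
  appears only after collapsing.\<close>

lemma box_tr_axioms:
  "p \<in> ax2_e \<Longrightarrow> \<exists>M \<in> ax2_b. collapse (box_tr p) M"
  "p \<in> ax3'_e \<Longrightarrow> \<exists>M \<in> ax3'_b. collapse (box_tr p) M"
  "p \<in> ax3_e \<Longrightarrow> \<exists>M \<in> ax3_b. collapse (box_tr p) M"
  "p \<in> ax4_e \<Longrightarrow> \<exists>M \<in> ax4_b. collapse (box_tr p) M"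
  "p \<in> ax5_e \<Longrightarrow> \<exists>M \<in> ax5_b. collapse (box_tr p) M"
  unfolding ax2_b_def ax2_e_def ax3'_b_def ax3'_e_def
      ax3_b_def ax3_e_def ax4_b_def ax4_e_def ax5_b_def ax5_e_def
  by (clarsimp, blast intro: collapse_intros)+

section \<open>The four dual pairs\<close>

lemma dual_S1SP: "dual_SCI_theory S1SP_eq S1SP"
proof (rule dual_SCI_theoryI[OF identity_logic_S1SP strict_b_S1SP])
  interpret e: identity_logic S1SP_eq by (rule identity_logic_S1SP)
  interpret b: box_logic S1SP using strict_b_S1SP by (rule box_logic.intro)
  show "{} \<turnstile>\<^sub>b[S1SP] p" if "p \<in> S1SP" for p
    using that unfolding derives_b_iff by (simp add: mp_closure.base)
  show "{} \<turnstile>\<^sub>b[S1SP] box_tr p" if "p \<in> S1SP_eq" for p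
  \<comment> \<open>SP is treated apart because its instances are not necessitated, so
    \<open>box_tr_with_AN\<close> does not cover them.\<close>
  proof (cases "p \<in> SP_e")
    case True
    then obtain q r c x where p: "p = (q \<equiv>\<^sub>e r) \<rightarrow>\<^sub>e (subst_e c x q \<equiv>\<^sub>e subst_e c x r)"
      unfolding SP_e_def by blast
    have "box_tr p \<in> SP_b"
      unfolding p SP_b_def by (auto simp only: box_tr.simps box_tr_subst)
    then show ?thesis
      unfolding derives_b_iff by (simp add: mp_closure.base S1SP_def)
  next
    case False
    with that have "p \<in> with_AN_e (CPC_e \<union> ax1_e \<union> ax2_e \<union> ax3'_e)"
      by (simp add: S1SP_eq_def)
    then have "b.ded {} (box_tr p)"
      by (rule b.box_tr_with_AN)
        (auto simp: S1SP_def with_AN_b_def dest!: box_tr_CPC box_tr_ax1 box_tr_axioms)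
    then show ?thesis unfolding derives_b_iff b.ded_def .
  qed
  show "{} \<turnstile>\<^sub>e[S1SP_eq] id_tr p" if "p \<in> S1SP" for p
  proof (cases "p \<in> SP_b")
    case True
    then obtain q r c x where p: "p = (q \<equiv>\<^sub>b r) \<rightarrow>\<^sub>b (subst_b c x q \<equiv>\<^sub>b subst_b c x r)"
      unfolding SP_b_def by blast
    \<comment> \<open>\<open>id_tr\<close> produces boxed biconditionals where SP in the other
      language has identities; \<open>identity_iff\<close> converts premise and conclusion.\<close>
    let ?q = "id_tr q" and ?r = "id_tr r" and ?c = "id_tr c"
    let ?H = "{\<box>\<^sub>e (?q \<leftrightarrow>\<^sub>e ?r)}"
    have "e.ded ?H (?q \<equiv>\<^sub>e ?r)"
      by (rule e.identity_iff[THEN iffD2], rule e.ded_hyp) simp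
    moreover have "e.ded ?H ((?q \<equiv>\<^sub>e ?r) \<rightarrow>\<^sub>e (subst_e ?c x ?q \<equiv>\<^sub>e subst_e ?c x ?r))"
      by (rule e.ded_ax) (auto simp: S1SP_eq_def SP_e_def)
    ultimately have "e.ded ?H (subst_e ?c x ?q \<equiv>\<^sub>e subst_e ?c x ?r)"
      using e.ded_mp by blast
    then have "e.ded {} (\<box>\<^sub>e (?q \<leftrightarrow>\<^sub>e ?r) \<rightarrow>\<^sub>e \<box>\<^sub>e (subst_e ?c x ?q \<leftrightarrow>\<^sub>e subst_e ?c x ?r))"
      by (rule e.deduction[OF e.identity_iff[THEN iffD1]])
    then show ?thesis
      unfolding derives_e_iff e.ded_def p by (simp add: id_tr_subst)
  next
    case False
    with that have "id_tr p \<in> S1SP_eq"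
      by (auto simp: S1SP_def S1SP_eq_def with_AN_b_def with_AN_e_def id_tr_axioms)
    then show ?thesis
      unfolding derives_e_iff by (simp add: mp_closure.base)
  qed
qed

text \<open>\<open>X\<close> and \<open>Y\<close> hold the axioms beyond \<open>S3\<close> and
  \<open>S3_eq\<close>, so that one argument serves three of the pairs.\<close>

lemma dual_S3_extension:
  assumes id: "\<And>p. p \<in> X \<Longrightarrow> id_tr p \<in> Y"
    and box: "\<And>p. p \<in> Y \<Longrightarrow> \<exists>M \<in> X. collapse (box_tr p) M"
  shows "dual_SCI_theory (with_AN_e (CPC_e \<union> ax1_e \<union> ax2_e \<union> ax3_e \<union> Y))
           (with_AN_b (CPC_b \<union> ax2_b \<union> ax3'_b \<union> ax3_b \<union> X))"
    (is "dual_SCI_theory ?Le ?L")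
proof -
  have Le: "identity_logic ?Le"
    by (rule identity_logic_S3) (auto simp: with_AN_e_def)
  have L: "strict_b ?L"
    by (rule strict_b_S3) (auto simp: with_AN_b_def)
  interpret e: identity_logic ?Le by (rule Le)
  interpret b: box_logic ?L using L by (rule box_logic.intro)
  show ?thesis
  proof (rule dual_SCI_theoryI[OF Le L])
    show "{} \<turnstile>\<^sub>b[?L] p" if "p \<in> S1SP" for p
    proof -
      have "b.ded {} p"
        using that b.SP_theorems b.ded_ax by (auto simp: S1SP_def with_AN_b_def)
      then show ?thesis unfolding derives_b_iff b.ded_def .
    qed
    show "{} \<turnstile>\<^sub>b[?L] box_tr p" if "p \<in> ?Le" for p
    proof -
      have "b.ded {} (box_tr p)"
        using that
        by (rule b.box_tr_with_AN)
          (auto simp: with_AN_b_def dest!: box_tr_CPC box_tr_ax1 box_tr_axioms box)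
      then show ?thesis unfolding derives_b_iff b.ded_def .
    qed
    show "{} \<turnstile>\<^sub>e[?Le] id_tr p" if "p \<in> ?L" for p
    proof -
      have box3': "e.ded {} (\<box>\<^sub>e q)" if q3: "q \<in> ax3'_e" for q
      proof -
        obtain a b c where q: "q = (\<box>\<^sub>e (a \<rightarrow>\<^sub>e b) \<and>\<^sub>e \<box>\<^sub>e (b \<rightarrow>\<^sub>e c)) \<rightarrow>\<^sub>e \<box>\<^sub>e (a \<rightarrow>\<^sub>e c)"
          using q3 unfolding ax3'_e_def by blast
        show ?thesis
          unfolding q by (rule e.box_axiom3') (auto simp: with_AN_e_def ax3_e_def ax2_e_def)
      qed
      \<comment> \<open>Only \<open>ax3'_b\<close> lacks a counterpart on the identity side; its
        instances, boxed or not, come from \<open>box3'\<close>.\<close>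
      have "p \<in> ax3'_b \<or> p \<in> BBox ` ax3'_b \<or> id_tr p \<in> ?Le"
        using that by (auto simp: with_AN_b_def with_AN_e_def id_tr_axioms id)
      then have "e.ded {} (id_tr p)"
        using box3' e.box_elim e.ded_ax id_tr_axioms(3) by auto
      then show ?thesis unfolding derives_e_iff e.ded_def .
    qed
  qed
qed

theorem theorem5p9:
  shows "dual_SCI_theory S1SP_eq S1SP \<and> dual_SCI_theory S3_eq S3 \<and>
         dual_SCI_theory S4_eq S4 \<and> dual_SCI_theory S5_eq S5"
proof (intro conjI)
  show "dual_SCI_theory S1SP_eq S1SP" by (rule dual_S1SP)
  show "dual_SCI_theory S3_eq S3"
    using dual_S3_extension[of "{}" "{}"] by (simp add: S3_eq_def S3_def)
  show "dual_SCI_theory S4_eq S4"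
    unfolding S4_eq_def S4_def
    by (rule dual_S3_extension) (rule id_tr_axioms box_tr_axioms, assumption)+
  show "dual_SCI_theory S5_eq S5"
    \<comment> \<open>Reassociation groups the last two axiom sets into one set of extra
      axioms.\<close>
    unfolding S5_eq_def S5_def Un_assoc[of _ ax4_e] Un_assoc[of _ ax4_b]
    by (rule dual_S3_extension) (use id_tr_axioms box_tr_axioms in blast)+
qed

end
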